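(* Let $d\ge2$, $\varrho>0$ and $\beta,\gamma>-\tfrac12$. For $n=0,1,2,\ldots$ and $(x,t),(y,s)\in{}_\varrho\mathbb V_0^{d+1}$, the reproducing kernel ${}_\varrho\mathsf P_n^E(w_{\beta,\gamma})$ on the double hyperboloid and the reproducing kernel $\mathsf P_n^E(w_{\beta,\gamma})$ on the double cone satisfy $${}_\varrho\mathsf P_n^E\big(w_{\beta,\gamma};(x,t),(y,s)\big)=\mathsf P_n^E\Big(w_{\beta,\gamma};\big(x,\sqrt{t^2-\varrho^2}\big),\big(y,\sqrt{s^2-\varrho^2}\big)\Big).$$
   Context: For $\varrho\ge0$, ${}_\varrho\mathbb V_0^{d+1}=\{(x,t)\in\mathbb R^d\times\mathbb R:\ \|x\|^2=t^2-\varrho^2,\ \varrho\le|t|\le\sqrt{\varrho^2+1}\}$ (a double hyperboloid if $\varrho>0$, the double cone if $\varrho=0$), with weight $$w_{\beta,\gamma}(t)=|t|(t^2-\varrho^2)^{\beta-\frac12}(\varrho^2+1-t^2)^{\gamma-\frac12},$$ so for $\varrho=0$ it is $|t|^{2\beta}(1-t^2)^{\gamma-\frac12}$. Integration means $\int f\,d\sigma=\int_{\varrho\le|t|\le\sqrt{\varrho^2+1}}(t^2-\varrho^2)^{\frac{d-1}2}\int_{\mathbb S^{d-1}}f(\sqrt{t^2-\varrho^2}\,\xi,t)\,d\sigma(\xi)\,dt$. The inner product is $\langle f,g\rangle=b\int f\,g\,w_{\beta,\gamma}(t)\,d\sigma$, with $b$ chosen so that $\langle1,1\rangle=1$. For each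 $\varrho\ge 0$, $\mathcal V_n^E({}_\varrho\mathbb V_0^{d+1},w_{\beta,\gamma})$ is the space of restrictions to ${}_\varrho\mathbb V_0^{d+1}$ of polynomials in $(x,t)$ of degree at most $n$ that are even in $t$ and orthogonal to all polynomials of degree at most $n-1$. Its reproducing kernel with respect to $\langle\cdot,\cdot\rangle$ is denoted ${}_\varrho\mathsf P_n^E(w_{\beta,\gamma};\cdot,\cdot)$ for $\varrho>0$ and $\mathsf P_n^E(w_{\beta,\gamma};\cdot,\cdot)$ for $\varrho=0$. *)

theory Defs
  imports "HOL-Analysis.Analysis"
begin

section \<open>Surface measure on the unit sphere\<close>

text \<open>
  The library has no surface measure.  The one on the unit sphere of a Euclidean space of
  dimension \<open>d\<close> is obtained from Lebesgue measure by the polar-coordinate (cone) formula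
  \<open>\<sigma>(A) = d * \<lambda>({r\<xi> | 0 < r < 1, \<xi> \<in> A})\<close>; see \<open>emeasure_sphere_measure\<close> below.
\<close>

definition sphere_measure :: "'a::euclidean_space measure" where
  "sphere_measure =
     scale_measure (of_nat DIM('a))
       (distr (restrict_space lborel (ball 0 1 - {0})) (restrict_space borel (sphere 0 1))
          (\<lambda>x. x /\<^sub>R norm x))"

lemma space_sphere_measure: "space (sphere_measure :: 'a::euclidean_space measure) = sphere 0 1"
  by (simp add: sphere_measure_def space_scale_measure space_restrict_space)

lemma sets_sphere_measure:
  "sets (sphere_measure :: 'a::euclidean_space measure) = sets (restrict_space borel (sphere 0 1))"
  by (simp add: sphere_measure_def)

lemma emeasure_sphere_measure:
  fixes A :: "'a::euclidean_space set"
  assumes A: "A \<in> sets borel" "A \<subseteq> sphere 0 1"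
  shows "emeasure sphere_measure A =
           of_nat DIM('a) * emeasure lborel {r *\<^sub>R \<xi> | r \<xi>. 0 < r \<and> r < 1 \<and> \<xi> \<in> A}"
proof -
  let ?B = "ball 0 1 - {0 :: 'a}"
  let ?N = "restrict_space (lborel :: 'a measure) ?B"
  let ?f = "\<lambda>x::'a. x /\<^sub>R norm x"
  have sp: "space ?N = ?B"
    by (simp add: space_restrict_space)
  have f: "?f \<in> measurable ?N (restrict_space borel (sphere 0 1))"
    by (rule measurable_restrict_space2) (auto simp: sp intro!: measurable_restrict_space1)
  have A': "A \<in> sets (restrict_space borel (sphere 0 1))"
    using A by (auto simp: sets_restrict_space_iff)
  have eq: "?f -` A \<inter> space ?N = {r *\<^sub>R \<xi> | r \<xi>. 0 < r \<and> r < 1 \<and> \<xi> \<in> A}" (is "?L = ?R")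
  proof (intro equalityI subsetI)
    fix x assume x: "x \<in> ?L"
    then have "x = norm x *\<^sub>R ?f x" "0 < norm x" "norm x < 1" "?f x \<in> A"
      by (auto simp: sp)
    then show "x \<in> ?R" by blast
  next
    fix x assume "x \<in> ?R"
    then obtain r \<xi> where r: "x = r *\<^sub>R \<xi>" "0 < r" "r < 1" "\<xi> \<in> A" by blast
    with A have "norm \<xi> = 1" by auto
    with r show "x \<in> ?L" by (auto simp: sp)
  qed
  have "emeasure ?N (?f -` A \<inter> space ?N) = emeasure lborel (?f -` A \<inter> space ?N)"
    by (rule emeasure_restrict_space) (auto simp: sp)
  then show ?thesis
    unfolding sphere_measure_def by (simp only: emeasure_scale_measure emeasure_distr[OF f A'] eq)
qed

section \<open>Polynomials of bounded total degree in \<open>(x,t)\<close>\<close>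

definition monomials_upto :: "nat \<Rightarrow> (('d::finite \<Rightarrow> nat) \<times> nat) set" where
  "monomials_upto n = {(\<alpha>, k). (\<Sum>i\<in>UNIV. \<alpha> i) + k \<le> n}"

lemma finite_monomials_upto: "finite (monomials_upto n :: (('d::finite \<Rightarrow> nat) \<times> nat) set)"
proof (rule finite_subset)
  show "(monomials_upto n :: (('d \<Rightarrow> nat) \<times> nat) set) \<subseteq> (UNIV \<rightarrow>\<^sub>E {..n}) \<times> {..n}"
  proof
    fix p :: "('d \<Rightarrow> nat) \<times> nat" assume "p \<in> monomials_upto n"
    then obtain \<alpha> k where p: "p = (\<alpha>, k)" and le: "(\<Sum>i\<in>UNIV. \<alpha> i) + k \<le> n"
      by (auto simp: monomials_upto_def)
    have "\<alpha> i \<le> n" for i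
      using member_le_sum[of i UNIV \<alpha>] le by simp
    with p le show "p \<in> (UNIV \<rightarrow>\<^sub>E {..n}) \<times> {..n}" by auto
  qed
  show "finite ((UNIV \<rightarrow>\<^sub>E {..n} :: ('d \<Rightarrow> nat) set) \<times> {..n})"
    by (intro finite_cartesian_product finite_PiE) auto
qed

definition polys_upto :: "nat \<Rightarrow> ((real ^ 'd) \<times> real \<Rightarrow> real) set" where
  "polys_upto n =
     {\<lambda>(x, t). \<Sum>(\<alpha>, k)\<in>monomials_upto n. c \<alpha> k * (\<Prod>i\<in>UNIV. (x $ i) ^ \<alpha> i) * t ^ k | c. True}"

definition even_in_t :: "((real ^ 'd) \<times> real \<Rightarrow> real) \<Rightarrow> bool" where
  "even_in_t f \<longleftrightarrow> (\<forall>x t. f (x, - t) = f (x, t))"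

section \<open>The double hyperboloid (\<open>\<rho> > 0\<close>) and the double cone (\<open>\<rho> = 0\<close>)\<close>

definition hyp_surface :: "real \<Rightarrow> ((real ^ 'd) \<times> real) set" where
  "hyp_surface \<rho> =
     {(x, t). (norm x)\<^sup>2 = t\<^sup>2 - \<rho>\<^sup>2 \<and> \<rho> \<le> \<bar>t\<bar> \<and> \<bar>t\<bar> \<le> sqrt (\<rho>\<^sup>2 + 1)}"

definition hyp_weight :: "real \<Rightarrow> real \<Rightarrow> real \<Rightarrow> real \<Rightarrow> real" where
  "hyp_weight \<rho> \<beta> \<gamma> t =
     \<bar>t\<bar> * (t\<^sup>2 - \<rho>\<^sup>2) powr (\<beta> - 1/2) * (\<rho>\<^sup>2 + 1 - t\<^sup>2) powr (\<gamma> - 1/2)"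

definition hyp_integral :: "real \<Rightarrow> ((real ^ 'd) \<times> real \<Rightarrow> real) \<Rightarrow> real" where
  "hyp_integral \<rho> f =
     (LINT t:{t. \<rho> \<le> \<bar>t\<bar> \<and> \<bar>t\<bar> \<le> sqrt (\<rho>\<^sup>2 + 1)}|lborel.
        (t\<^sup>2 - \<rho>\<^sup>2) powr ((real CARD('d) - 1) / 2) *
        (LINT \<xi>|sphere_measure. f (sqrt (t\<^sup>2 - \<rho>\<^sup>2) *\<^sub>R \<xi>, t)))"

definition hyp_const :: "'d::finite itself \<Rightarrow> real \<Rightarrow> real \<Rightarrow> real \<Rightarrow> real" where
  "hyp_const _ \<rho> \<beta> \<gamma> =
     1 / hyp_integral \<rho> (\<lambda>(x :: real ^ 'd, t). hyp_weight \<rho> \<beta> \<gamma> t)"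

definition hyp_inner ::
  "real \<Rightarrow> real \<Rightarrow> real \<Rightarrow> ((real ^ 'd) \<times> real \<Rightarrow> real) \<Rightarrow> ((real ^ 'd) \<times> real \<Rightarrow> real) \<Rightarrow> real" where
  "hyp_inner \<rho> \<beta> \<gamma> f g =
     hyp_const TYPE('d) \<rho> \<beta> \<gamma> *
     hyp_integral \<rho> (\<lambda>(x, t). f (x, t) * g (x, t) * hyp_weight \<rho> \<beta> \<gamma> t)"

section \<open>Even orthogonal polynomials and their reproducing kernel\<close>

text \<open>
  Functions on the surface are represented by extensional functions (\<open>restrict\<close>).  Quantifying
  over all degrees \<open>m < n\<close> expresses ``degree at most \<open>n - 1\<close>'' also for \<open>n = 0\<close>, where the
  orthogonality condition is void.
\<close>

definition even_orth_space ::
  "real \<Rightarrow> real \<Rightarrow> real \<Rightarrow> nat \<Rightarrow> ((real ^ 'd) \<times> real \<Rightarrow> real) set" where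
  "even_orth_space \<rho> \<beta> \<gamma> n =
     {restrict f (hyp_surface \<rho>) | f.
        f \<in> polys_upto n \<and> even_in_t f \<and>
        (\<forall>m<n. \<forall>g\<in>polys_upto m. hyp_inner \<rho> \<beta> \<gamma> f g = 0)}"

definition is_reproducing_kernel ::
  "'p set \<Rightarrow> ('p \<Rightarrow> real) set \<Rightarrow> (('p \<Rightarrow> real) \<Rightarrow> ('p \<Rightarrow> real) \<Rightarrow> real) \<Rightarrow> ('p \<times> 'p \<Rightarrow> real) \<Rightarrow> bool" where
  "is_reproducing_kernel S V ip K \<longleftrightarrow>
     K \<in> extensional (S \<times> S) \<and>
     (\<forall>q\<in>S. (\<lambda>p\<in>S. K (p, q)) \<in> V \<and> (\<forall>f\<in>V. ip f (\<lambda>p\<in>S. K (p, q)) = f q))"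

definition reproducing_kernel ::
  "'p set \<Rightarrow> ('p \<Rightarrow> real) set \<Rightarrow> (('p \<Rightarrow> real) \<Rightarrow> ('p \<Rightarrow> real) \<Rightarrow> real) \<Rightarrow> ('p \<times> 'p \<Rightarrow> real)" where
  "reproducing_kernel S V ip = (THE K. is_reproducing_kernel S V ip K)"

lemma reproducing_kernel_eqI:
  assumes sym: "\<And>f g. ip f g = ip g f" and K: "is_reproducing_kernel S V ip K"
  shows "reproducing_kernel S V ip = K"
  unfolding reproducing_kernel_def
proof (rule the_equality[where P = "is_reproducing_kernel S V ip", OF K])
  fix L assume L: "is_reproducing_kernel S V ip L"
  have *: "A (p, q) = B (q, p)"
    if A: "is_reproducing_kernel S V ip A" and B: "is_reproducing_kernel S V ip B"
      and "p \<in> S" "q \<in> S" for A B p q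
  proof -
    let ?A = "\<lambda>r\<in>S. A (r, q)" and ?B = "\<lambda>r\<in>S. B (r, p)"
    have "ip ?A ?B = ?A p" "ip ?B ?A = ?B q"
      using A B \<open>p \<in> S\<close> \<open>q \<in> S\<close> unfolding is_reproducing_kernel_def by blast+
    with sym[of ?A ?B] \<open>p \<in> S\<close> \<open>q \<in> S\<close> show ?thesis by simp
  qed
  show "L = K"
  proof (rule extensionalityI)
    show "L \<in> extensional (S \<times> S)" "K \<in> extensional (S \<times> S)"
      using K L by (auto simp: is_reproducing_kernel_def)
    fix z assume "z \<in> S \<times> S"
    then show "L z = K z" using *[OF L K] *[OF K K] by (metis mem_Sigma_iff surj_pair)
  qed
qed

lemma hyp_inner_commute: "hyp_inner \<rho> \<beta> \<gamma> f g = hyp_inner \<rho> \<beta> \<gamma> g f"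
  by (simp add: hyp_inner_def mult.commute)

definition even_kernel ::
  "real \<Rightarrow> real \<Rightarrow> real \<Rightarrow> nat \<Rightarrow> ((real ^ 'd) \<times> real) \<times> ((real ^ 'd) \<times> real) \<Rightarrow> real" where
  "even_kernel \<rho> \<beta> \<gamma> n =
     reproducing_kernel (hyp_surface \<rho>) (even_orth_space \<rho> \<beta> \<gamma> n) (hyp_inner \<rho> \<beta> \<gamma>)"

end

theory Submission
  imports Defs
begin

text \<open>
  On the surface \<open>t\<^sup>2 = (norm x)\<^sup>2 + \<rho>\<^sup>2\<close>, so the polynomials of degree at most \<open>n\<close> that are even in \<open>t\<close>
  restrict to exactly the polynomials of degree at most \<open>n\<close> in \<open>x\<close> alone, for every \<open>\<rho> \<ge> 0\<close>.  The
  substitution \<open>u = t\<^sup>2 - \<rho>\<^sup>2\<close> turns the inner product into one over the unit ball that does not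
  depend on \<open>\<rho>\<close>.  Hence the kernels for all \<open>\<rho> \<ge> 0\<close> are pullbacks under \<open>(x, t) \<mapsto> x\<close> of a single
  kernel on the ball, and the two points on the double cone have the same \<open>x\<close>-coordinates as the
  two points on the hyperboloid.  As the kernel is defined by a description operator, its existence has to
  be shown, which needs a definite inner product on a finite-dimensional space.
\<close>

section \<open>Kernels of finite-dimensional function spaces\<close>

text \<open>The spanning family is indexed and may be linearly dependent; no basis is ever extracted
  from it.\<close>

definition fun_span :: "'i set \<Rightarrow> ('i \<Rightarrow> 'a \<Rightarrow> real) \<Rightarrow> ('a \<Rightarrow> real) set" where
  "fun_span I b = {\<lambda>x. \<Sum>i\<in>I. c i * b i x | c. True}"

lemma fun_span_add: "f \<in> fun_span I b \<Longrightarrow> g \<in> fun_span I b \<Longrightarrow> (\<lambda>x. f x + g x) \<in> fun_span I b"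
proof -
  assume "f \<in> fun_span I b" "g \<in> fun_span I b"
  then obtain c d where "f = (\<lambda>x. \<Sum>i\<in>I. c i * b i x)" "g = (\<lambda>x. \<Sum>i\<in>I. d i * b i x)"
    by (auto simp: fun_span_def)
  then have "(\<lambda>x. f x + g x) = (\<lambda>x. \<Sum>i\<in>I. (c i + d i) * b i x)"
    by (simp add: sum.distrib distrib_right)
  then show ?thesis by (auto simp: fun_span_def)
qed

lemma fun_span_scale: "f \<in> fun_span I b \<Longrightarrow> (\<lambda>x. r * f x) \<in> fun_span I b"
proof -
  assume "f \<in> fun_span I b"
  then obtain c where "f = (\<lambda>x. \<Sum>i\<in>I. c i * b i x)"
    by (auto simp: fun_span_def)
  then have "(\<lambda>x. r * f x) = (\<lambda>x. \<Sum>i\<in>I. (r * c i) * b i x)"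
    by (simp add: sum_distrib_left mult.assoc)
  then show ?thesis unfolding fun_span_def by (intro CollectI exI[of _ "\<lambda>i. r * c i"]) simp
qed

lemma fun_span_diff: "f \<in> fun_span I b \<Longrightarrow> g \<in> fun_span I b \<Longrightarrow> (\<lambda>x. f x - g x) \<in> fun_span I b"
  using fun_span_add[OF _ fun_span_scale[of g I b "-1"], of f] by simp

lemma fun_span_zero: "(\<lambda>x. 0) \<in> fun_span I b"
  by (auto simp: fun_span_def intro!: exI[of _ "\<lambda>i. 0"])

lemma fun_span_sum:
  "(\<And>j. j \<in> J \<Longrightarrow> f j \<in> fun_span I b) \<Longrightarrow> (\<lambda>x. \<Sum>j\<in>J. f j x) \<in> fun_span I b"
  by (induction J rule: infinite_finite_induct) (auto intro: fun_span_zero fun_span_add)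

lemma fun_span_base:
  assumes "finite I" "i \<in> I" shows "b i \<in> fun_span I b"
proof -
  have "b i = (\<lambda>x. \<Sum>j\<in>I. (if j = i then 1 else 0) * b j x)"
    using assms by (simp add: if_distrib[of "\<lambda>c. c * _"] cong: if_cong)
  then show ?thesis
    unfolding fun_span_def by (intro CollectI exI[of _ "\<lambda>j. if j = i then 1 else 0"]) simp
qed

lemma fun_span_insert:
  assumes "finite I" "j \<notin> I" "f \<in> fun_span (insert j I) b"
  obtains g c where "g \<in> fun_span I b" "f = (\<lambda>x. g x + c * b j x)"
proof -
  obtain c where c: "f = (\<lambda>x. \<Sum>i\<in>insert j I. c i * b i x)"
    using assms by (auto simp: fun_span_def)
  show ?thesis
    by (rule that[of "\<lambda>x. \<Sum>i\<in>I. c i * b i x" "c j"])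
       (use assms in \<open>auto simp: c fun_span_def\<close>)
qed

lemma fun_span_mono:
  assumes "finite J" "I \<subseteq> J" shows "fun_span I b \<subseteq> fun_span J b"
proof
  fix f assume "f \<in> fun_span I b"
  then obtain c where "f = (\<lambda>x. \<Sum>i\<in>I. c i * b i x)" by (auto simp: fun_span_def)
  then show "f \<in> fun_span J b"
    using assms by (auto intro!: fun_span_sum fun_span_scale fun_span_base intro: finite_subset)
qed

text \<open>\<open>X\<close> is the ambient space on which \<open>ip\<close> is bilinear, and
  \<open>S\<close> is the set that \<open>ip\<close> sees: products depend only on values on
  \<open>S\<close>, and \<open>ip f f = 0\<close> forces \<open>f\<close> to vanish there only.
  Anisotropy is asked for instead of positivity, so a normalizing factor merely has to be
  nonzero.\<close>

locale function_inner_product =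
  fixes X :: "('a \<Rightarrow> real) set" and S :: "'a set" and ip :: "('a \<Rightarrow> real) \<Rightarrow> ('a \<Rightarrow> real) \<Rightarrow> real"
  assumes add_closed: "f \<in> X \<Longrightarrow> g \<in> X \<Longrightarrow> (\<lambda>x. f x + g x) \<in> X"
    and scale_closed: "f \<in> X \<Longrightarrow> (\<lambda>x. r * f x) \<in> X"
    and zero_closed: "(\<lambda>x. 0) \<in> X"
    and ip_commute: "ip f g = ip g f"
    and ip_add: "f \<in> X \<Longrightarrow> g \<in> X \<Longrightarrow> h \<in> X \<Longrightarrow> ip (\<lambda>x. f x + g x) h = ip f h + ip g h"
    and ip_scale: "f \<in> X \<Longrightarrow> h \<in> X \<Longrightarrow> ip (\<lambda>x. r * f x) h = r * ip f h"
    and ip_cong: "(\<And>x. x \<in> S \<Longrightarrow> f x = g x) \<Longrightarrow> ip f h = ip g h"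
    and ip_definite: "f \<in> X \<Longrightarrow> ip f f = 0 \<Longrightarrow> x \<in> S \<Longrightarrow> f x = 0"
begin

lemma ip_add_right: "f \<in> X \<Longrightarrow> g \<in> X \<Longrightarrow> h \<in> X \<Longrightarrow> ip h (\<lambda>x. f x + g x) = ip h f + ip h g"
  by (metis ip_add ip_commute)

lemma ip_scale_right: "f \<in> X \<Longrightarrow> h \<in> X \<Longrightarrow> ip h (\<lambda>x. r * f x) = r * ip h f"
  by (metis ip_scale ip_commute)

lemma ip_diff_right: "f \<in> X \<Longrightarrow> g \<in> X \<Longrightarrow> h \<in> X \<Longrightarrow> ip h (\<lambda>x. f x - g x) = ip h f - ip h g"
  using ip_add_right[OF _ scale_closed[of g "-1"], of f h] ip_scale_right[of g h "-1"] by simp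

lemma fun_span_subset: "finite I \<Longrightarrow> b ` I \<subseteq> X \<Longrightarrow> fun_span I b \<subseteq> X"
proof
  fix f assume I: "finite I" "b ` I \<subseteq> X" and "f \<in> fun_span I b"
  then obtain c where f: "f = (\<lambda>x. \<Sum>i\<in>I. c i * b i x)" by (auto simp: fun_span_def)
  show "f \<in> X" unfolding f using I
    by (induction I) (auto intro!: add_closed scale_closed zero_closed)
qed

text \<open>The induction step projects the new spanning function onto the old span, using the
  induction hypothesis for the functional \<open>\<lambda>f. ip f (b j)\<close>.\<close>

lemma riesz_fun_span:
  assumes "finite I" "b ` I \<subseteq> X"
    and "\<And>f g. f \<in> X \<Longrightarrow> g \<in> X \<Longrightarrow> L (\<lambda>x. f x + g x) = L f + L g"
    and "\<And>f r. f \<in> X \<Longrightarrow> L (\<lambda>x. r * f x) = r * L f"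
    and "\<And>f g. (\<And>x. x \<in> S \<Longrightarrow> f x = g x) \<Longrightarrow> L f = L g"
  shows "\<exists>k\<in>fun_span I b. \<forall>f\<in>fun_span I b. ip f k = L f"
  using assms
proof (induction I arbitrary: L)
  case empty
  have "L (\<lambda>x. 0) = 0" "ip (\<lambda>x. 0) (\<lambda>x. 0) = 0"
    using empty(3)[OF zero_closed, of 0] ip_scale[OF zero_closed zero_closed, of 0] by simp_all
  then show ?case by (auto simp: fun_span_def)
next
  case (insert j I L)
  let ?V = "fun_span I b" and ?W = "fun_span (insert j I) b"
  have VX: "?V \<subseteq> X" and WX: "?W \<subseteq> X" and bj: "b j \<in> X" and IX: "b ` I \<subseteq> X"
    using insert.prems(1) insert.hyps(1) fun_span_subset[of I b] fun_span_subset[of "insert j I" b] by auto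
  have VW: "?V \<subseteq> ?W" using insert.hyps by (intro fun_span_mono) auto
  have "\<exists>k\<in>?V. \<forall>f\<in>?V. ip f k = L f"
    by (rule insert.IH[OF IX]) (fact insert.prems)+
  then obtain k where k: "k \<in> ?V" "\<And>f. f \<in> ?V \<Longrightarrow> ip f k = L f" by blast
  have "\<exists>p\<in>?V. \<forall>f\<in>?V. ip f p = ip f (b j)"
  proof (rule insert.IH[OF IX])
    show "ip f (b j) = ip g (b j)" if "\<And>x. x \<in> S \<Longrightarrow> f x = g x" for f g
      using that by (rule ip_cong)
  qed (simp_all add: ip_add ip_scale bj)
  then obtain p where p: "p \<in> ?V" "\<And>f. f \<in> ?V \<Longrightarrow> ip f p = ip f (b j)" by blast
  \<comment> \<open>The residual of \<open>b j\<close> after projection: it is orthogonal to the old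
    span and, together with it, generates the new one.\<close>
  define e where "e = (\<lambda>x. b j x - p x)"
  have "b j \<in> ?W" using insert.hyps by (intro fun_span_base) auto
  then have eW: "e \<in> ?W" unfolding e_def using p VW by (intro fun_span_diff) auto
  then have eX: "e \<in> X" using WX by blast
  have kX: "k \<in> X" and pX: "p \<in> X" using k p VX by auto
  have orth: "ip f e = 0" if "f \<in> ?V" for f
    using that p VX bj pX unfolding e_def
    by (subst ip_diff_right) auto
  \<comment> \<open>If \<open>ip e e = 0\<close>, then \<open>e\<close> vanishes on
    \<open>S\<close>, so \<open>b j\<close> contributes nothing new there and
    \<open>L e = 0\<close>; the default 0 then satisfies the equation for \<open>r\<close>.\<close>
  define r where "r = (if ip e e = 0 then 0 else L e / ip e e)"
  have r: "r * ip e e = L e"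
  proof (cases "ip e e = 0")
    case True
    then have "L e = L (\<lambda>x. 0 * e x)"
      using ip_definite[OF eX] by (intro insert.prems(4)) auto
    also have "\<dots> = 0" using insert.prems(3)[OF eX, of 0] by simp
    finally show ?thesis using True by simp
  qed (simp add: r_def)
  show ?case
  proof (intro bexI[of _ "\<lambda>x. k x + r * e x"] ballI)
    show "(\<lambda>x. k x + r * e x) \<in> ?W"
      using k VW eW by (intro fun_span_add fun_span_scale) auto
    fix f assume "f \<in> ?W"
    then obtain g c where g: "g \<in> ?V" and f: "f = (\<lambda>x. g x + c * b j x)"
      using fun_span_insert[OF insert.hyps(1,2)] by blast
    \<comment> \<open>Writing \<open>b j\<close> as \<open>p + e\<close> splits \<open>f\<close>
      into \<open>h\<close> in the old span and \<open>c\<close> times \<open>e\<close>, which is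
      orthogonal to that span, so the mixed products drop out.\<close>
    define h where "h = (\<lambda>x. g x + c * p x)"
    have h: "h \<in> ?V" unfolding h_def using g p by (intro fun_span_add fun_span_scale)
    then have hX: "h \<in> X" using VX by blast
    have feq: "f = (\<lambda>x. h x + c * e x)" by (simp add: f h_def e_def algebra_simps)
    have "ip f (\<lambda>x. k x + r * e x) = ip f k + r * ip f e"
      using kX eX hX by (simp add: ip_add_right ip_scale_right scale_closed add_closed feq)
    also have "\<dots> = ip h k + c * ip e k + r * (ip h e + c * ip e e)"
      using kX eX hX by (simp add: feq ip_add ip_scale scale_closed)
    also have "\<dots> = L h + c * L e"
      using k(2)[OF h] orth[OF h] orth[OF k(1)] ip_commute[of e k] r by (simp add: algebra_simps)
    also have "\<dots> = L f"
      using hX eX by (simp add: feq insert.prems(2,3) scale_closed)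
    finally show "ip f (\<lambda>x. k x + r * e x) = L f" .
  qed
qed

text \<open>The kernel function of the orthogonal complement is the difference of the kernel functions
  of the two spans.\<close>

lemma orthogonal_complement_kernel:
  assumes I: "finite I" "b ` I \<subseteq> X" and JI: "J \<subseteq> I" and q: "q \<in> S"
  shows "\<exists>k\<in>fun_span I b. (\<forall>g\<in>fun_span J b. ip k g = 0) \<and>
           (\<forall>f\<in>fun_span I b. (\<forall>g\<in>fun_span J b. ip f g = 0) \<longrightarrow> ip f k = f q)"
proof -
  have J: "finite J" "b ` J \<subseteq> X" using I JI finite_subset by auto
  have sub: "fun_span J b \<subseteq> fun_span I b" by (rule fun_span_mono[OF I(1) JI])
  obtain k where k: "k \<in> fun_span I b" "\<And>f. f \<in> fun_span I b \<Longrightarrow> ip f k = f q"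
    using riesz_fun_span[OF I, of "\<lambda>f. f q"] q by auto
  obtain l where l: "l \<in> fun_span J b" "\<And>f. f \<in> fun_span J b \<Longrightarrow> ip f l = f q"
    using riesz_fun_span[OF J, of "\<lambda>f. f q"] q by auto
  have X: "fun_span I b \<subseteq> X" by (rule fun_span_subset[OF I])
  have *: "ip f (\<lambda>x. k x - l x) = ip f k - ip f l" if "f \<in> fun_span I b" for f
  proof -
    have "k \<in> X" "l \<in> X" "f \<in> X" using that k l sub X by auto
    then show ?thesis by (simp add: ip_diff_right)
  qed
  show ?thesis
  \<comment> \<open>On the smaller span both \<open>k\<close> and \<open>l\<close> evaluate at
    \<open>q\<close>, so their difference annihilates it. A function orthogonal to that span does
    not see \<open>l\<close> and is left with the evaluation by \<open>k\<close>.\<close>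
  proof (intro bexI[of _ "\<lambda>x. k x - l x"] conjI ballI impI)
    show "(\<lambda>x. k x - l x) \<in> fun_span I b"
      using k l sub by (intro fun_span_diff) auto
    fix g assume g: "g \<in> fun_span J b"
    show "ip (\<lambda>x. k x - l x) g = 0"
      using *[of g] k(2)[of g] l(2)[of g] g sub by (subst ip_commute) auto
  next
    fix f assume f: "f \<in> fun_span I b" and "\<forall>g\<in>fun_span J b. ip f g = 0"
    then show "ip f (\<lambda>x. k x - l x) = f q"
      using *[OF f] k(2)[OF f] l(1) by simp
  qed
qed

end

section \<open>Polynomials in \<open>x\<close> alone\<close>

definition power_monomial :: "('d \<Rightarrow> nat) \<Rightarrow> real ^ 'd \<Rightarrow> real" where
  "power_monomial \<alpha> x = (\<Prod>i\<in>UNIV. (x $ i) ^ \<alpha> i)"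

definition exponents_upto :: "nat \<Rightarrow> ('d::finite \<Rightarrow> nat) set" where
  "exponents_upto n = {\<alpha>. (\<Sum>i\<in>UNIV. \<alpha> i) \<le> n}"

abbreviation x_polys_upto :: "nat \<Rightarrow> (real ^ 'd \<Rightarrow> real) set" where
  "x_polys_upto n \<equiv> fun_span (exponents_upto n) power_monomial"

lemma finite_exponents_upto: "finite (exponents_upto n :: ('d::finite \<Rightarrow> nat) set)"
proof -
  have "exponents_upto n \<subseteq> fst ` (monomials_upto n :: (('d \<Rightarrow> nat) \<times> nat) set)"
    by (auto simp: exponents_upto_def monomials_upto_def image_iff intro!: exI[of _ 0])
  then show ?thesis using finite_monomials_upto finite_surj by blast
qed

lemma exponents_upto_mono: "m \<le> n \<Longrightarrow> exponents_upto m \<subseteq> exponents_upto n"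
  by (auto simp: exponents_upto_def)

lemma x_polys_upto_mono: "m \<le> n \<Longrightarrow> x_polys_upto m \<subseteq> x_polys_upto n"
  by (rule fun_span_mono[OF finite_exponents_upto exponents_upto_mono])

lemma x_polys_upto_coordinate:
  fixes p :: "real ^ 'd \<Rightarrow> real"
  assumes "p \<in> x_polys_upto n" shows "(\<lambda>x. x $ i * p x) \<in> x_polys_upto (Suc n)"
proof -
  obtain c where p: "p = (\<lambda>x. \<Sum>\<alpha>\<in>exponents_upto n. c \<alpha> * power_monomial \<alpha> x)"
    using assms by (auto simp: fun_span_def)
  have eq: "x $ i * power_monomial \<alpha> x = power_monomial (\<alpha>(i := Suc (\<alpha> i))) x" for \<alpha> and x :: "real ^ 'd"
    unfolding power_monomial_def
    by (simp add: prod.remove[of UNIV i] ac_simps)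
  have "power_monomial (\<alpha>(i := Suc (\<alpha> i))) \<in> x_polys_upto (Suc n)"
    if "\<alpha> \<in> exponents_upto n" for \<alpha> :: "'d \<Rightarrow> nat"
    using that
    by (intro fun_span_base finite_exponents_upto)
       (simp add: exponents_upto_def sum.remove[of UNIV i])
  then have "(\<lambda>x. \<Sum>\<alpha>\<in>exponents_upto n. c \<alpha> * power_monomial (\<alpha>(i := Suc (\<alpha> i))) x) \<in> x_polys_upto (Suc n)"
    by (intro fun_span_sum fun_span_scale)
  then show ?thesis
    by (simp add: p sum_distrib_left mult.left_commute eq)
qed

text \<open>For \<open>r = \<rho>\<^sup>2\<close> the factor stands for \<open>t ^ (2 * k)\<close>
  on the surface and costs the same degree: the squared norm is the sum of the squared coordinates,
  and each square takes two applications of \<open>x_polys_upto_coordinate\<close>.\<close>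

lemma x_polys_upto_norm_power:
  assumes "p \<in> x_polys_upto n"
  shows "(\<lambda>x. ((norm x)\<^sup>2 + r) ^ k * p x) \<in> x_polys_upto (n + 2 * k)"
proof (induction k)
  case (Suc k)
  let ?q = "\<lambda>x. ((norm x)\<^sup>2 + r) ^ k * p x"
  have "(\<lambda>x. x $ i * (x $ i * ?q x)) \<in> x_polys_upto (n + 2 * Suc k)" for i
    using x_polys_upto_coordinate[OF x_polys_upto_coordinate[OF Suc.IH]] by simp
  moreover have "(\<lambda>x. r * ?q x) \<in> x_polys_upto (n + 2 * Suc k)"
    using fun_span_scale[OF Suc.IH] x_polys_upto_mono[of "n + 2 * k" "n + 2 * Suc k"] by auto
  ultimately have "(\<lambda>x. (\<Sum>i\<in>UNIV. x $ i * (x $ i * ?q x)) + r * ?q x) \<in> x_polys_upto (n + 2 * Suc k)"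
    by (intro fun_span_add fun_span_sum)
  moreover have "(\<Sum>i\<in>UNIV. x $ i * (x $ i * ?q x)) + r * ?q x = ((norm x)\<^sup>2 + r) ^ Suc k * p x"
    for x :: "real ^ 'a"
  proof -
    have "(\<Sum>i\<in>UNIV. x $ i * (x $ i * ?q x)) = (\<Sum>i\<in>UNIV. x $ i * x $ i) * ?q x"
      by (simp add: sum_distrib_right mult.assoc)
    also have "(\<Sum>i\<in>UNIV. x $ i * x $ i) = (norm x)\<^sup>2"
      by (simp add: power2_norm_eq_inner inner_vec_def)
    finally show ?thesis by (simp add: algebra_simps)
  qed
  ultimately show ?case by simp
qed (use assms in simp)

lemma continuous_on_x_polys_upto: "p \<in> x_polys_upto n \<Longrightarrow> continuous_on A p"
  by (auto simp: fun_span_def power_monomial_def intro!: continuous_intros)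

lemma continuous_on_polys_upto: "f \<in> polys_upto n \<Longrightarrow> continuous_on A f"
  by (auto simp: polys_upto_def case_prod_beta' intro!: continuous_intros)

lemma x_polys_upto_in_polys_upto:
  assumes "p \<in> x_polys_upto n" shows "(\<lambda>(x, t). p x) \<in> polys_upto n"
proof -
  obtain c where p: "p = (\<lambda>x. \<Sum>\<alpha>\<in>exponents_upto n. c \<alpha> * power_monomial \<alpha> x)"
    using assms by (auto simp: fun_span_def)
  let ?c = "\<lambda>\<alpha> k. if k = 0 then c \<alpha> else 0"
  have "(\<Sum>(\<alpha>, k)\<in>monomials_upto n. ?c \<alpha> k * (\<Prod>i\<in>UNIV. (x $ i) ^ \<alpha> i) * t ^ k) = p x" for x t
  proof -
    have "(\<Sum>(\<alpha>, k)\<in>monomials_upto n. ?c \<alpha> k * (\<Prod>i\<in>UNIV. (x $ i) ^ \<alpha> i) * t ^ k) =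
      (\<Sum>(\<alpha>, k)\<in>(\<lambda>\<alpha>. (\<alpha>, 0)) ` exponents_upto n. ?c \<alpha> k * (\<Prod>i\<in>UNIV. (x $ i) ^ \<alpha> i) * t ^ k)"
      by (rule sum.mono_neutral_right[OF finite_monomials_upto])
         (auto simp: monomials_upto_def exponents_upto_def image_iff)
    also have "\<dots> = p x"
      by (subst sum.reindex) (auto simp: inj_on_def p power_monomial_def)
    finally show ?thesis .
  qed
  then have "(\<lambda>(x, t). p x) = (\<lambda>(x, t). \<Sum>(\<alpha>, k)\<in>monomials_upto n. ?c \<alpha> k * (\<Prod>i\<in>UNIV. (x $ i) ^ \<alpha> i) * t ^ k)"
    by (auto simp: fun_eq_iff)
  then show ?thesis unfolding polys_upto_def by (intro CollectI exI[of _ ?c]) simp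
qed

text \<open>On the surface \<open>t\<^sup>2 = (norm x)\<^sup>2 + \<rho>\<^sup>2\<close>, so the even powers of \<open>t\<close> can be eliminated without
  raising the degree; the odd powers cancel.\<close>

lemma polys_upto_even_part:
  fixes g :: "(real ^ 'd) \<times> real \<Rightarrow> real"
  assumes "g \<in> polys_upto n"
  obtains q where "q \<in> x_polys_upto n"
    and "\<And>x t. t\<^sup>2 = (norm x)\<^sup>2 + r \<Longrightarrow> g (x, t) + g (x, - t) = 2 * q x"
proof -
  obtain c where g: "g = (\<lambda>(x, t). \<Sum>(\<alpha>, k)\<in>monomials_upto n. c \<alpha> k * (\<Prod>i\<in>UNIV. (x $ i) ^ \<alpha> i) * t ^ k)"
    using assms by (auto simp: polys_upto_def)
  \<comment> \<open>Even powers of \<open>t\<close> become powers of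
    \<open>(norm x)\<^sup>2 + r\<close>; odd powers get the coefficient 0.\<close>
  define q where "q = (\<lambda>x::real^'d. \<Sum>p\<in>monomials_upto n.
    (if even (snd p) then c (fst p) (snd p) else 0) *
    (((norm x)\<^sup>2 + r) ^ (snd p div 2) * power_monomial (fst p) x))"
  show ?thesis
  proof (rule that)
    have "(\<lambda>x. ((norm x)\<^sup>2 + r) ^ (snd p div 2) * power_monomial (fst p) x) \<in> x_polys_upto n"
      if "p \<in> monomials_upto n" for p :: "('d \<Rightarrow> nat) \<times> nat"
    proof -
      let ?m = "\<Sum>i\<in>UNIV. fst p i"
      have "power_monomial (fst p) \<in> x_polys_upto ?m"
        by (intro fun_span_base finite_exponents_upto) (simp add: exponents_upto_def)
      \<comment> \<open>Since \<open>2 * (k div 2) \<le> k\<close>, the total degree does not rise.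
        The bound covers odd \<open>k\<close> as well, so no case distinction on parity is
        made.\<close>
      moreover have "?m + 2 * (snd p div 2) \<le> n"
        using that by (auto simp: monomials_upto_def case_prod_beta')
      ultimately show ?thesis
        using x_polys_upto_norm_power[of "power_monomial (fst p)" ?m r "snd p div 2"] x_polys_upto_mono by blast
    qed
    then show "q \<in> x_polys_upto n"
      unfolding q_def by (intro fun_span_sum fun_span_scale)
  next
    fix x :: "real ^ 'd" and t assume t: "t\<^sup>2 = (norm x)\<^sup>2 + r"
    have *: "t ^ k + (- t) ^ k = (if even k then 2 * ((norm x)\<^sup>2 + r) ^ (k div 2) else 0)" for k
      by (auto simp: t[symmetric] power_mult[symmetric])
    have "g (x, t) + g (x, - t) =
      (\<Sum>p\<in>monomials_upto n. c (fst p) (snd p) * power_monomial (fst p) x * (t ^ snd p + (- t) ^ snd p))"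
      by (simp add: g case_prod_beta' sum.distrib distrib_left power_monomial_def)
    also have "\<dots> = 2 * q x"
      unfolding * q_def sum_distrib_left by (rule sum.cong) auto
    finally show "g (x, t) + g (x, - t) = 2 * q x" .
  qed
qed

section \<open>Integration over the sphere and substitution\<close>

text \<open>The cone over the whole sphere lies in the unit ball, which has finite Lebesgue
  measure.\<close>

lemma finite_measure_sphere_measure: "finite_measure (sphere_measure :: 'a::euclidean_space measure)"
proof
  let ?C = "{r *\<^sub>R \<xi> | r (\<xi> :: 'a). 0 < r \<and> r < 1 \<and> \<xi> \<in> sphere 0 1}"
  have "emeasure lborel ?C \<le> emeasure lborel (ball (0::'a) 1)"
    by (rule emeasure_mono) auto
  also have "\<dots> < \<infinity>"
    by (rule emeasure_bounded_finite) auto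
  finally show "emeasure sphere_measure (space (sphere_measure :: 'a measure)) \<noteq> \<infinity>"
    by (simp add: emeasure_sphere_measure space_sphere_measure ennreal_mult_eq_top_iff)
qed

text \<open>The cone over a nonempty relatively open set is the preimage of an open set under radial
  projection, hence open, and nonempty; so it has positive Lebesgue measure. This drives the
  definiteness of the inner product.\<close>

lemma emeasure_sphere_measure_pos:
  fixes U :: "'a::euclidean_space set"
  assumes U: "open U" "U \<inter> sphere 0 1 \<noteq> {}"
  shows "emeasure sphere_measure (U \<inter> sphere 0 1) > 0"
proof -
  let ?C = "{r *\<^sub>R \<xi> | r \<xi>. 0 < r \<and> r < 1 \<and> \<xi> \<in> U \<inter> sphere 0 1}"
  have eq: "?C = (ball 0 1 - {0}) \<inter> (\<lambda>x. x /\<^sub>R norm x) -` U"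
  proof (intro equalityI subsetI)
    fix x assume x: "x \<in> (ball 0 1 - {0}) \<inter> (\<lambda>x. x /\<^sub>R norm x) -` U"
    then have "x = norm x *\<^sub>R (x /\<^sub>R norm x)" "0 < norm x" "norm x < 1"
      "x /\<^sub>R norm x \<in> U \<inter> sphere 0 1"
      by auto
    then show "x \<in> ?C" by blast
  qed auto
  have "continuous_on (ball 0 1 - {0::'a}) (\<lambda>x. x /\<^sub>R norm x)"
    by (intro continuous_intros) auto
  then have "open ?C"
    unfolding eq by (rule continuous_open_preimage) (use U in auto)
  moreover have "?C \<noteq> {}"
  proof -
    obtain \<xi> where "\<xi> \<in> U \<inter> sphere 0 1" using U by blast
    then have "(1/2) *\<^sub>R \<xi> \<in> ?C" by (auto intro!: exI[of _ "1/2"])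
    then show ?thesis by blast
  qed
  ultimately have "\<not> negligible ?C" by (rule open_not_negligible)
  moreover have "?C \<in> sets borel" using \<open>open ?C\<close> by simp
  ultimately have "emeasure lborel ?C \<noteq> 0"
    by (metis (no_types, lifting) emeasure_completion lmeasurable_iff_integrable negligible_iff_emeasure0
        null_setsI null_sets_completionI negligible_iff_null_sets sets_lborel)
  then show ?thesis
    using U by (subst emeasure_sphere_measure) (auto simp: zero_less_iff_neq_zero)
qed

lemma continuous_on_slice:
  assumes "continuous_on UNIV (\<lambda>(t, \<xi>). g t \<xi>)"
  shows "continuous_on A (g t)"
proof -
  have "continuous_on A (\<lambda>\<xi>. (\<lambda>(t, \<xi>). g t \<xi>) (t, \<xi>))"
    by (rule continuous_on_compose2[OF assms]) (auto intro!: continuous_intros)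
  then show ?thesis by simp
qed

lemma integrable_sphere_measure:
  fixes f :: "'a::euclidean_space \<Rightarrow> real"
  assumes f: "continuous_on (sphere 0 1) f"
  shows "integrable sphere_measure f"
proof -
  interpret finite_measure "sphere_measure :: 'a measure" by (rule finite_measure_sphere_measure)
  have "compact (f ` sphere 0 1)"
    by (rule compact_continuous_image[OF f]) auto
  then obtain M where M: "\<And>\<xi>. \<xi> \<in> sphere 0 1 \<Longrightarrow> norm (f \<xi>) \<le> M"
    using compact_imp_bounded bounded_iff by (metis imageI)
  have "f \<in> borel_measurable sphere_measure"
    using borel_measurable_continuous_on_restrict[OF f]
    by (simp add: measurable_cong_sets[OF sets_sphere_measure refl])
  then show ?thesis
    by (rule integrable_const_bound[of _ M, rotated]) (use M in \<open>auto simp: space_sphere_measure intro!: AE_I2\<close>)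
qed

lemma borel_measurable_sphere_integral:
  fixes g :: "real \<Rightarrow> 'a::euclidean_space \<Rightarrow> real"
  assumes g: "continuous_on UNIV (\<lambda>(t, \<xi>). g t \<xi>)"
  shows "(\<lambda>t. LINT \<xi>|sphere_measure. g t \<xi>) \<in> borel_measurable borel"
proof -
  interpret finite_measure "sphere_measure :: 'a measure" by (rule finite_measure_sphere_measure)
  \<comment> \<open>The sigma-algebra of \<open>sphere_measure\<close> is a trace on the sphere, so
    \<open>g\<close> is pulled back along the measurable inclusion into the whole space.\<close>
  have id: "(\<lambda>\<xi>. \<xi>) \<in> measurable (sphere_measure :: 'a measure) borel"
    by (simp add: measurable_cong_sets[OF sets_sphere_measure refl] measurable_restrict_space1)
  have "(\<lambda>p. (fst p, snd p)) \<in> measurable (borel \<Otimes>\<^sub>M (sphere_measure :: 'a measure)) (borel :: (real \<times> 'a) measure)"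
    unfolding borel_prod[symmetric]
    by (intro measurable_Pair measurable_fst measurable_compose[OF measurable_snd id])
  from measurable_compose[OF this borel_measurable_continuous_onI[OF g]]
  have "(\<lambda>p. g (fst p) (snd p)) \<in> borel_measurable (borel \<Otimes>\<^sub>M (sphere_measure :: 'a measure))"
    by simp
  then show ?thesis
    by (intro borel_measurable_lebesgue_integral) (simp add: case_prod_beta')
qed

text \<open>By joint continuity \<open>g\<close> is bounded on the compact product of
  \<open>K\<close> and the sphere, and the sphere has finite mass.\<close>

lemma sphere_integral_bounded:
  fixes g :: "real \<Rightarrow> 'a::euclidean_space \<Rightarrow> real"
  assumes g: "continuous_on UNIV (\<lambda>(t, \<xi>). g t \<xi>)" and K: "compact K"
  obtains M where "\<And>t. t \<in> K \<Longrightarrow> \<bar>LINT \<xi>|sphere_measure. g t \<xi>\<bar> \<le> M"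
proof -
  interpret finite_measure "sphere_measure :: 'a measure" by (rule finite_measure_sphere_measure)
  have "compact ((\<lambda>(t, \<xi>). g t \<xi>) ` (K \<times> sphere 0 1))"
    by (rule compact_continuous_image[OF continuous_on_subset[OF g]]) (auto intro!: compact_Times K)
  then obtain B where B: "\<And>t \<xi>. t \<in> K \<Longrightarrow> \<xi> \<in> sphere 0 1 \<Longrightarrow> \<bar>g t \<xi>\<bar> \<le> B"
    unfolding bounded_iff[of "_ :: real set"] using compact_imp_bounded bounded_iff
    by (smt (verit) SigmaI image_eqI old.prod.case real_norm_def)
  show ?thesis
  proof (rule that)
    fix t assume t: "t \<in> K"
    have "\<bar>LINT \<xi>|sphere_measure. g t \<xi>\<bar> \<le> (LINT \<xi>|sphere_measure. \<bar>g t \<xi>\<bar>)"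
      by (rule integral_abs_bound)
    also have "\<dots> \<le> (LINT \<xi>|(sphere_measure :: 'a measure). B)"
      using B[OF t]
      by (intro integral_mono integrable_abs integrable_sphere_measure continuous_on_slice[OF g])
         (auto simp: space_sphere_measure)
    finally show "\<bar>LINT \<xi>|sphere_measure. g t \<xi>\<bar> \<le> (LINT \<xi>|(sphere_measure :: 'a measure). B)" .
  qed
qed

text \<open>Separates the two sources of trouble: \<open>c\<close> carries the endpoint
  singularities of the weight, while \<open>J\<close> is a bounded sphere integral of continuous
  data.\<close>

lemma set_integrable_mult_bounded:
  fixes c J :: "real \<Rightarrow> real"
  assumes c: "set_integrable lborel K c" and J: "J \<in> borel_measurable borel"
    and M: "\<And>t. t \<in> K \<Longrightarrow> \<bar>J t\<bar> \<le> M"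
  shows "set_integrable lborel K (\<lambda>t. c t * J t)"
  unfolding set_integrable_def
proof (rule Bochner_Integration.integrable_bound)
  have c': "integrable lborel (\<lambda>t. indicator K t *\<^sub>R c t)"
    using c by (simp add: set_integrable_def)
  then show "integrable lborel (\<lambda>t. M *\<^sub>R (indicator K t *\<^sub>R c t))"
    by (rule integrable_scaleR_right)
  have "(\<lambda>t. (indicator K t *\<^sub>R c t) * J t) \<in> borel_measurable lborel"
    using borel_measurable_integrable[OF c'] J by (intro borel_measurable_times) auto
  then show "(\<lambda>t. indicator K t *\<^sub>R (c t * J t)) \<in> borel_measurable lborel"
    by (simp add: mult.assoc)
  have "norm (indicator K t *\<^sub>R (c t * J t)) \<le> norm (M *\<^sub>R (indicator K t *\<^sub>R c t))" for t
  proof (cases "t \<in> K")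
    case True
    then have "\<bar>J t\<bar> \<le> \<bar>M\<bar>" using M[OF True] by linarith
    then show ?thesis
      using mult_right_mono[of "\<bar>J t\<bar>" "\<bar>M\<bar>" "\<bar>c t\<bar>"] True by (simp add: abs_mult mult.commute)
  qed simp
  then show "AE t in lborel. norm (indicator K t *\<^sub>R (c t * J t)) \<le> norm (M *\<^sub>R (indicator K t *\<^sub>R c t))"
    by simp
qed

section \<open>Weighted integrals over intervals: Beta density, reflection and substitution\<close>

definition beta_density :: "real \<Rightarrow> real \<Rightarrow> real \<Rightarrow> real" where
  "beta_density a b u = u powr (a - 1) * (1 - u) powr (b - 1)"

lemma set_integrable_beta_density:
  assumes "a > 0" "b > 0"
  shows "set_integrable lborel {0..1} (beta_density a b)"
proof -
  have "beta_density a b absolutely_integrable_on {0..1}"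
    using has_integral_Beta_real[OF assms]
    by (intro nonnegative_absolutely_integrable_1) (auto simp: beta_density_def[abs_def] integrable_on_def)
  \<comment> \<open>Absolute integrability refers to the completed measure; for a Borel function it
    agrees with integrability over \<open>lborel\<close>.\<close>
  then show ?thesis
    unfolding set_integrable_def
    by (subst (asm) integrable_completion) (auto simp: beta_density_def[abs_def])
qed

lemma set_integral_symmetric_interval:
  fixes F :: "real \<Rightarrow> real"
  assumes \<rho>: "\<rho> \<ge> 0" and F: "set_integrable lborel {\<rho>..R} F"
    and F': "set_integrable lborel {\<rho>..R} (\<lambda>t. F (- t))"
  shows "(LINT t:{t. \<rho> \<le> \<bar>t\<bar> \<and> \<bar>t\<bar> \<le> R}|lborel. F t) = (LINT t:{\<rho>..R}|lborel. F t + F (- t))"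
proof -
  let ?I = "\<lambda>t. indicator {\<rho>..R} t :: real"
  have i1: "integrable lborel (\<lambda>t. ?I t * F t)" and i2: "integrable lborel (\<lambda>t. ?I t * F (- t))"
    using F F' by (auto simp: set_integrable_def)
  have i3: "integrable lborel (\<lambda>t. ?I (- t) * F t)"
    using lborel_integrable_real_affine[OF i2, of "-1" 0] by simp
  have "(LINT t:{t. \<rho> \<le> \<bar>t\<bar> \<and> \<bar>t\<bar> \<le> R}|lborel. F t) = (LINT t|lborel. ?I t * F t + ?I (- t) * F t)"
    unfolding set_lebesgue_integral_def
  proof (rule integral_cong_AE)
    \<comment> \<open>If \<open>\<rho> = 0\<close>, both halves contain the point 0 and the right
      side counts it twice, so the identity is claimed off this null set.\<close>
    have *: "indicator {t. \<rho> \<le> \<bar>t\<bar> \<and> \<bar>t\<bar> \<le> R} t *\<^sub>R F t = ?I t * F t + ?I (- t) * F t" if "t \<noteq> 0" for t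
      using that \<rho> by (auto simp: indicator_def)
    show "AE t in lborel. indicator {t. \<rho> \<le> \<bar>t\<bar> \<and> \<bar>t\<bar> \<le> R} t *\<^sub>R F t = ?I t * F t + ?I (- t) * F t"
      using AE_lborel_singleton[of 0] by eventually_elim (rule *)
    show m: "(\<lambda>t. ?I t * F t + ?I (- t) * F t) \<in> borel_measurable lborel"
      using i1 i3 by (intro borel_measurable_integrable Bochner_Integration.integrable_add)
    \<comment> \<open>Measurability of the left integrand comes from the right one, from which it
      differs at most at 0; \<open>F\<close> itself is not assumed measurable.\<close>
    have "(\<lambda>t. indicator {t. \<rho> \<le> \<bar>t\<bar> \<and> \<bar>t\<bar> \<le> R} t *\<^sub>R F t) =
      (\<lambda>t. if t = 0 then indicator {t. \<rho> \<le> \<bar>t\<bar> \<and> \<bar>t\<bar> \<le> R} 0 * F 0 else ?I t * F t + ?I (- t) * F t)"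
      using * by (intro ext) auto
    also have "\<dots> \<in> borel_measurable lborel"
      using m by (intro measurable_If) auto
    finally show "(\<lambda>t. indicator {t. \<rho> \<le> \<bar>t\<bar> \<and> \<bar>t\<bar> \<le> R} t *\<^sub>R F t) \<in> borel_measurable lborel" .
  qed
  also have "\<dots> = (LINT t|lborel. ?I t * F t) + (LINT t|lborel. ?I (- t) * F t)"
    using i1 i3 by (rule Bochner_Integration.integral_add)
  also have "(LINT t|lborel. ?I (- t) * F t) = (LINT t|lborel. ?I t * F (- t))"
    by (subst lborel_integral_real_affine[of "-1" _ 0]) auto
  also have "(LINT t|lborel. ?I t * F t) + \<dots> = (LINT t|lborel. ?I t * F t + ?I t * F (- t))"
    using i1 i2 by (rule Bochner_Integration.integral_add[symmetric])
  finally show ?thesis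
    by (simp add: set_lebesgue_integral_def algebra_simps)
qed

text \<open>The substitution \<open>u = t\<^sup>2 - \<rho>\<^sup>2\<close> is monotone for
  \<open>t \<ge> \<rho>\<close> and sends the endpoints to 0 and 1 for every \<rho>; this is where
  \<rho> disappears.\<close>

lemma set_integral_substitution:
  fixes f :: "real \<Rightarrow> real"
  assumes \<rho>: "\<rho> \<ge> 0" and f: "set_integrable lborel {0..1} f"
  shows "set_integrable lborel {\<rho>..sqrt (\<rho>\<^sup>2 + 1)} (\<lambda>t. f (t\<^sup>2 - \<rho>\<^sup>2) * (2 * t))"
    and "(LINT t:{\<rho>..sqrt (\<rho>\<^sup>2 + 1)}|lborel. f (t\<^sup>2 - \<rho>\<^sup>2) * (2 * t)) = (LINT u:{0..1}|lborel. f u)"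
proof -
  let ?R = "sqrt (\<rho>\<^sup>2 + 1)" and ?g = "\<lambda>t. t\<^sup>2 - \<rho>\<^sup>2"
  have g: "?g \<rho> = 0" "?g ?R = 1" by simp_all
  have f': "set_integrable lborel {?g \<rho>..?g ?R} f" unfolding g by (rule f)
  have d: "(?g has_real_derivative 2 * t) (at t)" for t
    by (auto intro!: derivative_eq_intros)
  have c: "continuous_on {\<rho>..?R} (\<lambda>t. 2 * t)" by (intro continuous_intros)
  have le: "\<rho> \<le> ?R" using \<rho> by (simp add: real_le_rsqrt)
  have pos: "0 \<le> 2 * t" if "t \<in> {\<rho>..?R}" for t using that \<rho> by simp
  note sub = integral_substitution[OF f' d c pos le]
  show "set_integrable lborel {\<rho>..?R} (\<lambda>t. f (?g t) * (2 * t))" by (rule sub(1))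
  show "(LINT t:{\<rho>..?R}|lborel. f (?g t) * (2 * t)) = (LINT u:{0..1}|lborel. f u)"
    using sub(2) unfolding g by (simp add: set_lebesgue_integral_def mult.commute)
qed

section \<open>Integration over the unit ball\<close>

text \<open>In dimension d this is the integral of \<open>h\<close> over the unit ball against the
  weight 2 |x|^(2a - d) (1 - |x|^2)^(b - 1), in polar coordinates with \<open>u\<close> the squared
  radius.\<close>

definition ball_integral :: "real \<Rightarrow> real \<Rightarrow> ('a::euclidean_space \<Rightarrow> real) \<Rightarrow> real" where
  "ball_integral a b h =
     (LINT u:{0..1}|lborel. beta_density a b u * (LINT \<xi>|sphere_measure. h (sqrt u *\<^sub>R \<xi>)))"

lemma continuous_on_dilate:
  fixes h :: "'a::euclidean_space \<Rightarrow> real"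
  assumes "continuous_on UNIV h"
  shows "continuous_on UNIV (\<lambda>(u, \<xi>). h (sqrt u *\<^sub>R \<xi>))"
  unfolding case_prod_beta'
  by (rule continuous_on_compose2[OF assms]) (auto intro!: continuous_intros)

lemma set_integrable_ball:
  fixes h :: "'a::euclidean_space \<Rightarrow> real"
  assumes "a > 0" "b > 0" and h: "continuous_on UNIV h"
  shows "set_integrable lborel {0..1}
    (\<lambda>u. beta_density a b u * (LINT \<xi>|sphere_measure. h (sqrt u *\<^sub>R \<xi>)))"
proof -
  obtain M where "\<And>u. u \<in> {0..1} \<Longrightarrow> \<bar>LINT \<xi>|sphere_measure. h (sqrt u *\<^sub>R \<xi>)\<bar> \<le> M"
    using sphere_integral_bounded[OF continuous_on_dilate[OF h], of "{0..1}"] by auto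
  then show ?thesis
    by (rule set_integrable_mult_bounded[OF set_integrable_beta_density[OF assms(1,2)]
          borel_measurable_sphere_integral[OF continuous_on_dilate[OF h]]])
qed

lemma integrable_sphere_dilate:
  fixes h :: "'a::euclidean_space \<Rightarrow> real"
  assumes "continuous_on UNIV h"
  shows "integrable sphere_measure (\<lambda>\<xi>. h (c *\<^sub>R \<xi>))"
  by (intro integrable_sphere_measure, rule continuous_on_compose2[OF assms])
     (auto intro!: continuous_intros)

lemma ball_integral_add:
  fixes f g :: "'a::euclidean_space \<Rightarrow> real"
  assumes ab: "a > 0" "b > 0" and f: "continuous_on UNIV f" and g: "continuous_on UNIV g"
  shows "ball_integral a b (\<lambda>x. f x + g x) = ball_integral a b f + ball_integral a b g"
  unfolding ball_integral_def
  by (subst set_integral_add(2)[symmetric])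
     (simp_all add: set_integrable_ball[OF ab f] set_integrable_ball[OF ab g]
        integrable_sphere_dilate[OF f] integrable_sphere_dilate[OF g] distrib_left)

lemma ball_integral_scale: "ball_integral a b (\<lambda>x. r * f x) = r * ball_integral a b f"
  by (simp add: ball_integral_def mult.left_commute)

lemma ball_integral_cong:
  fixes f g :: "'a::euclidean_space \<Rightarrow> real"
  assumes "\<And>x. x \<in> cball 0 1 \<Longrightarrow> f x = g x"
  shows "ball_integral a b f = ball_integral a b g"
  unfolding ball_integral_def
  by (intro set_lebesgue_integral_cong ballI allI impI arg_cong2[where f = "(*)"]
        Bochner_Integration.integral_cong)
     (auto simp: space_sphere_measure intro!: assms)

text \<open>A nonzero value makes \<open>h\<close> positive on an open set. Hence the sphere
  integral is positive for an open set of squared radii, where the Beta density is positive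
  too.\<close>

lemma ball_integral_definite:
  fixes h :: "'a::euclidean_space \<Rightarrow> real"
  assumes ab: "a > 0" "b > 0" and h: "continuous_on UNIV h" and nonneg: "\<And>x. h x \<ge> 0"
    and zero: "ball_integral a b h = 0" and y: "y \<in> cball 0 1"
  shows "h y = 0"
proof (rule ccontr)
  assume "h y \<noteq> 0"
  define U where "U = {x. h x > 0}"
  have U: "open U"
    unfolding U_def using h by (intro open_Collect_less) (auto intro: continuous_intros)
  have "y \<in> U" using \<open>h y \<noteq> 0\<close> nonneg[of y] by (simp add: U_def)
  \<comment> \<open>The point \<open>y\<close> may lie on the boundary sphere; an open set that
    meets the closure of the ball already meets the open ball.\<close>
  moreover have "y \<in> closure (ball 0 1)" using y by simp
  ultimately have "U \<inter> ball 0 1 \<noteq> {}"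
    using U open_Int_closure_eq_empty[of U "ball 0 1"] by blast
  \<comment> \<open>A point other than the origin is wanted, since it must determine a
    direction.\<close>
  moreover have "U \<inter> ball 0 1 \<noteq> {0}"
    using U not_open_singleton[of "0::'a"] by (metis open_Int open_ball)
  ultimately have "\<not> U \<inter> ball 0 1 \<subseteq> {0}" by (simp add: subset_singleton_iff)
  then obtain z where "z \<in> U \<inter> ball 0 1" "z \<notin> {0}" by (meson subsetI)
  then have z: "z \<in> U" "z \<noteq> 0" "norm z < 1" by simp_all
  define \<xi>\<^sub>0 where "\<xi>\<^sub>0 = z /\<^sub>R norm z"
  \<comment> \<open>The squared radii at which the ray through \<open>z\<close> lies in
    \<open>U\<close>. The endpoints 0 and 1 are left out because the Beta density may vanish
    there.\<close>
  define W where "W = {u. sqrt u *\<^sub>R \<xi>\<^sub>0 \<in> U} \<inter> {0<..<1}"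
  have "open ((\<lambda>u. sqrt u *\<^sub>R \<xi>\<^sub>0) -` U)"
    using U by (intro open_vimage continuous_intros)
  then have W: "open W" by (auto simp: W_def vimage_def)
  have "(norm z)\<^sup>2 \<in> W"
    using z by (simp add: W_def \<xi>\<^sub>0_def abs_square_less_1)
  then have "\<not> negligible W" using W by (intro open_not_negligible) auto
  let ?H = "\<lambda>u. LINT \<xi>|sphere_measure. h (sqrt u *\<^sub>R \<xi>)"
  let ?F = "\<lambda>u. indicator {0..1} u *\<^sub>R (beta_density a b u * ?H u)"
  have Hnn: "?H u \<ge> 0" for u using nonneg by (intro Bochner_Integration.integral_nonneg) auto
  have int: "integrable lborel ?F"
    using set_integrable_ball[OF ab h] by (simp add: set_integrable_def)
  have Fnn: "AE u in lborel. 0 \<le> ?F u"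
    using Hnn by (simp add: beta_density_def)
  have "AE u in lborel. ?F u = 0"
    using zero unfolding integral_nonneg_eq_0_iff_AE[OF int Fnn, symmetric]
    by (simp add: ball_integral_def set_lebesgue_integral_def)
  moreover have "?F u \<noteq> 0" if u: "u \<in> W" for u
  proof -
    let ?V = "(\<lambda>\<xi>. sqrt u *\<^sub>R \<xi>) -` U"
    have "\<xi>\<^sub>0 \<in> ?V \<inter> sphere 0 1" using u z by (auto simp: W_def \<xi>\<^sub>0_def)
    moreover have "open ?V" using U by (intro open_vimage continuous_intros)
    ultimately have pos: "emeasure sphere_measure (?V \<inter> sphere 0 1) > 0"
      by (intro emeasure_sphere_measure_pos) auto
    have "?H u \<noteq> 0"
    proof
      assume "?H u = 0"
      then have "AE \<xi> in sphere_measure. h (sqrt u *\<^sub>R \<xi>) = 0"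
        by (subst (asm) integral_nonneg_eq_0_iff_AE[OF integrable_sphere_dilate[OF h]])
           (simp_all add: nonneg)
      then have AE: "AE \<xi> in sphere_measure. \<xi> \<notin> ?V \<inter> sphere 0 1"
        by eventually_elim (auto simp: U_def)
      have "?V \<in> sets borel" using \<open>open ?V\<close> by (rule borel_open)
      then have "?V \<inter> sphere 0 1 \<in> sets sphere_measure"
        unfolding sets_sphere_measure by (subst sets_restrict_space_iff) simp_all
      then have "?V \<inter> sphere 0 1 \<in> null_sets sphere_measure"
        using AE by (rule AE_iff_null_sets[THEN iffD2])
      then show False using pos null_setsD1 by fastforce
    qed
    then show ?thesis using u by (auto simp: W_def beta_density_def)
  qed
  ultimately have "AE u in lborel. u \<notin> W" 
    by (elim eventually_mono) blast
  then have "W \<in> null_sets lborel"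
    using borel_open[OF W] AE_iff_null_sets[of W lborel] by simp
  then have "negligible W"
    using negligible_iff_null_sets null_sets_completionI by blast
  with \<open>\<not> negligible W\<close> show False ..
qed

section \<open>Reduction of the hyperboloid to the ball\<close>

text \<open>\<open>F\<close> may be a \<open>restrict\<close>, so continuity is asked of a function
  \<open>G\<close> that agrees with it on the surface. The weight is even in \<open>t\<close>;
  folding the sheets \<open>t\<close> and \<open>- t\<close> together leaves the even part
  \<open>h\<close> of \<open>G\<close>, a function of \<open>x\<close>, and the substitution then
  removes \<rho>.\<close>

lemma hyp_integral_eq_ball_integral:
  fixes F G :: "(real ^ 'd) \<times> real \<Rightarrow> real" and h :: "real ^ 'd \<Rightarrow> real"
  assumes \<rho>: "\<rho> \<ge> 0" and \<beta>: "\<beta> > - 1/2" and \<gamma>: "\<gamma> > - 1/2"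
    and G: "continuous_on UNIV G" and h: "continuous_on UNIV h"
    and FG: "\<And>p. p \<in> hyp_surface \<rho> \<Longrightarrow> F p = G p"
    and even_part: "\<And>x t. t\<^sup>2 = (norm x)\<^sup>2 + \<rho>\<^sup>2 \<Longrightarrow> G (x, t) + G (x, - t) = 2 * h x"
  shows "hyp_integral \<rho> (\<lambda>(x, t). F (x, t) * hyp_weight \<rho> \<beta> \<gamma> t) =
    ball_integral (\<beta> + real CARD('d) / 2) (\<gamma> + 1/2) h"
proof -
  let ?a = "\<beta> + real CARD('d) / 2" and ?b = "\<gamma> + 1/2" and ?R = "sqrt (\<rho>\<^sup>2 + 1)"
  have "0 < CARD('d)" by simp
  then have "real CARD('d) \<ge> 1" by linarith
  then have ab: "?a > 0" "?b > 0" using \<beta> \<gamma> by linarith+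
  \<comment> \<open>All weights together: the exponent (d - 1)/2 of the surface element and \<beta>
    - 1/2 of the weight add up to \<open>?a - 1\<close>, and the factor |t| is half the derivative
    of the substitution when t is nonnegative.\<close>
  define c where "c = (\<lambda>t. \<bar>t\<bar> * beta_density ?a ?b (t\<^sup>2 - \<rho>\<^sup>2))"
  define J where "J = (\<lambda>t. LINT \<xi>|sphere_measure. G (sqrt (t\<^sup>2 - \<rho>\<^sup>2) *\<^sub>R \<xi>, t))"
  let ?H = "\<lambda>u. LINT \<xi>|sphere_measure. h (sqrt u *\<^sub>R \<xi>)"
  have weight: "(t\<^sup>2 - \<rho>\<^sup>2) powr ((real CARD('d) - 1) / 2) * (I * hyp_weight \<rho> \<beta> \<gamma> t) = c t * I" for t I
  proof -
    have "?a - 1 = (real CARD('d) - 1) / 2 + (\<beta> - 1/2)" "?b - 1 = \<gamma> - 1/2"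
      "1 - (t\<^sup>2 - \<rho>\<^sup>2) = \<rho>\<^sup>2 + 1 - t\<^sup>2"
      by (simp_all add: field_simps)
    then show ?thesis
      by (simp only: c_def beta_density_def hyp_weight_def powr_add) (simp only: ac_simps)
  qed
  have range: "\<rho>\<^sup>2 \<le> t\<^sup>2" "t\<^sup>2 \<le> \<rho>\<^sup>2 + 1" if "\<rho> \<le> \<bar>t\<bar>" "\<bar>t\<bar> \<le> ?R" for t
  proof -
    show "\<rho>\<^sup>2 \<le> t\<^sup>2" using that(1) \<rho> by (metis abs_of_nonneg abs_le_square_iff)
    show "t\<^sup>2 \<le> \<rho>\<^sup>2 + 1"
      using power_mono[OF that(2), of 2] by simp
  qed
  have step1: "hyp_integral \<rho> (\<lambda>(x, t). F (x, t) * hyp_weight \<rho> \<beta> \<gamma> t) =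
      (LINT t:{t. \<rho> \<le> \<bar>t\<bar> \<and> \<bar>t\<bar> \<le> ?R}|lborel. c t * J t)"
    unfolding hyp_integral_def
  proof (intro set_lebesgue_integral_cong ballI allI impI)
    fix t assume t: "t \<in> {t. \<rho> \<le> \<bar>t\<bar> \<and> \<bar>t\<bar> \<le> ?R}"
    have "(LINT \<xi>|sphere_measure. F (sqrt (t\<^sup>2 - \<rho>\<^sup>2) *\<^sub>R \<xi>, t)) = J t"
      unfolding J_def using t range[of t]
      by (intro Bochner_Integration.integral_cong)
         (auto simp: space_sphere_measure hyp_surface_def power_mult_distrib intro!: FG)
    then show "(t\<^sup>2 - \<rho>\<^sup>2) powr ((real CARD('d) - 1) / 2) *
        (LINT \<xi>|sphere_measure. (case (sqrt (t\<^sup>2 - \<rho>\<^sup>2) *\<^sub>R \<xi>, t) of (x, t) \<Rightarrow>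
          F (x, t) * hyp_weight \<rho> \<beta> \<gamma> t)) = c t * J t"
      by (simp add: weight)
  qed simp
  \<comment> \<open>The sign \<open>s\<close> is used with the values 1 and -1, one for each
    sheet.\<close>
  have contJ: "continuous_on UNIV (\<lambda>(t, \<xi>). G (sqrt (t\<^sup>2 - \<rho>\<^sup>2) *\<^sub>R \<xi>, s * t))" for s
    unfolding case_prod_beta'
    by (rule continuous_on_compose2[OF G]) (auto intro!: continuous_intros)
  have c_int: "set_integrable lborel {\<rho>..?R} c"
  proof -
    have "set_integrable lborel {\<rho>..?R} (\<lambda>t. 1/2 * (beta_density ?a ?b (t\<^sup>2 - \<rho>\<^sup>2) * (2 * t)))"
      by (intro set_integrable_mult_right set_integral_substitution(1) \<rho> set_integrable_beta_density ab)
    then show ?thesis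
      by (rule set_integrable_cong[THEN iffD1, rotated -1]) (use \<rho> in \<open>auto simp: c_def\<close>)
  qed
  have cJ_int: "set_integrable lborel {\<rho>..?R} (\<lambda>t. c t * (LINT \<xi>|sphere_measure. G (sqrt (t\<^sup>2 - \<rho>\<^sup>2) *\<^sub>R \<xi>, s * t)))" for s
  proof -
    obtain M where "\<And>t. t \<in> {\<rho>..?R} \<Longrightarrow> \<bar>LINT \<xi>|sphere_measure. G (sqrt (t\<^sup>2 - \<rho>\<^sup>2) *\<^sub>R \<xi>, s * t)\<bar> \<le> M"
      using sphere_integral_bounded[OF contJ, of "{\<rho>..?R}"] by auto
    then show ?thesis
      by (rule set_integrable_mult_bounded[OF c_int borel_measurable_sphere_integral[OF contJ]])
  qed
  have "(LINT t:{t. \<rho> \<le> \<bar>t\<bar> \<and> \<bar>t\<bar> \<le> ?R}|lborel. c t * J t) =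
      (LINT t:{\<rho>..?R}|lborel. c t * J t + c (- t) * J (- t))"
    using cJ_int[of 1] cJ_int[of "-1"] \<rho>
    by (intro set_integral_symmetric_interval) (simp_all add: J_def c_def)
  also have "\<dots> = (LINT t:{\<rho>..?R}|lborel. beta_density ?a ?b (t\<^sup>2 - \<rho>\<^sup>2) * ?H (t\<^sup>2 - \<rho>\<^sup>2) * (2 * t))"
  proof (intro set_lebesgue_integral_cong ballI allI impI)
    fix t assume t: "t \<in> {\<rho>..?R}"
    then have r: "\<rho>\<^sup>2 \<le> t\<^sup>2" using range[of t] \<rho> by auto
    have "J t + J (- t) = (LINT \<xi>|sphere_measure.
        G (sqrt (t\<^sup>2 - \<rho>\<^sup>2) *\<^sub>R \<xi>, t) + G (sqrt (t\<^sup>2 - \<rho>\<^sup>2) *\<^sub>R \<xi>, - t))"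
      using continuous_on_slice[OF contJ[of 1], of _ t] continuous_on_slice[OF contJ[of "-1"], of _ t]
      by (simp add: J_def integrable_sphere_measure)
    also have "\<dots> = (LINT \<xi>|sphere_measure. 2 * h (sqrt (t\<^sup>2 - \<rho>\<^sup>2) *\<^sub>R \<xi>))"
      using r by (intro Bochner_Integration.integral_cong)
        (auto simp: space_sphere_measure power_mult_distrib intro!: even_part)
    finally have "J t + J (- t) = 2 * ?H (t\<^sup>2 - \<rho>\<^sup>2)" by simp
    moreover have "c t * J t + c (- t) * J (- t) = c t * (J t + J (- t))"
      by (simp add: c_def distrib_left)
    ultimately show "c t * J t + c (- t) * J (- t) =
        beta_density ?a ?b (t\<^sup>2 - \<rho>\<^sup>2) * ?H (t\<^sup>2 - \<rho>\<^sup>2) * (2 * t)"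
      using t \<rho> by (simp add: c_def)
  qed simp
  also have "\<dots> = ball_integral ?a ?b h"
    unfolding ball_integral_def
    by (rule set_integral_substitution(2)[OF \<rho> set_integrable_ball[OF ab h]])
  finally show ?thesis unfolding step1 .
qed

section \<open>The normalized inner product on the ball and its kernel functions\<close>

lemma ball_function_inner_product:
  assumes ab: "a > 0" "b > 0" and C: "C \<noteq> 0"
  shows "function_inner_product {f :: 'a::euclidean_space \<Rightarrow> real. continuous_on UNIV f} (cball 0 1)
    (\<lambda>f g. C * ball_integral a b (\<lambda>x. f x * g x))"
proof
  fix f g h :: "'a \<Rightarrow> real" and r :: real and x :: 'a
  assume f: "f \<in> {f. continuous_on UNIV f}"
  show "(\<lambda>x. r * f x) \<in> {f. continuous_on UNIV f}" using f by (auto intro: continuous_intros)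
  show "f x = 0" if "C * ball_integral a b (\<lambda>x. f x * f x) = 0" "x \<in> cball 0 1"
  proof -
    have "f x * f x = 0"
      by (rule ball_integral_definite[OF ab, of "\<lambda>x. f x * f x"]) (use f that C in \<open>auto intro!: continuous_intros\<close>)
    then show ?thesis by simp
  qed
  assume h: "h \<in> {f. continuous_on UNIV f}"
  show "C * ball_integral a b (\<lambda>x. r * f x * h x) = r * (C * ball_integral a b (\<lambda>x. f x * h x))"
    by (simp add: mult.assoc ball_integral_scale)
next
  fix f g :: "'a \<Rightarrow> real"
  assume f: "f \<in> {f. continuous_on UNIV f}" and g: "g \<in> {f. continuous_on UNIV f}"
  then show "(\<lambda>x. f x + g x) \<in> {f. continuous_on UNIV f}" by (auto intro: continuous_intros)
  fix h :: "'a \<Rightarrow> real" assume h: "h \<in> {f. continuous_on UNIV f}"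
  show "C * ball_integral a b (\<lambda>x. (f x + g x) * h x) =
      C * ball_integral a b (\<lambda>x. f x * h x) + C * ball_integral a b (\<lambda>x. g x * h x)"
    unfolding distrib_right using f g h
    by (subst ball_integral_add[OF ab]) (auto intro!: continuous_intros simp: distrib_left)
next
  fix f g h :: "'a \<Rightarrow> real" assume "\<And>x. x \<in> cball 0 1 \<Longrightarrow> f x = g x"
  then show "C * ball_integral a b (\<lambda>x. f x * h x) = C * ball_integral a b (\<lambda>x. g x * h x)"
    using ball_integral_cong[of "\<lambda>x. f x * h x" "\<lambda>x. g x * h x" a b] by simp
qed (auto simp: mult.commute)

text \<open>The inner product for the weight |x|^(2\<beta>) (1 - |x|^2)^(\<gamma> - 1/2) on the unit
  ball; constant factors of the weight cancel in the quotient.\<close>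

definition ball_inner :: "real \<Rightarrow> real \<Rightarrow> (real ^ 'd \<Rightarrow> real) \<Rightarrow> (real ^ 'd \<Rightarrow> real) \<Rightarrow> real" where
  "ball_inner \<beta> \<gamma> f g =
     1 / ball_integral (\<beta> + real CARD('d) / 2) (\<gamma> + 1/2) (\<lambda>x :: real ^ 'd. 1) *
     ball_integral (\<beta> + real CARD('d) / 2) (\<gamma> + 1/2) (\<lambda>x. f x * g x)"

text \<open>The two arguments are treated differently on purpose: \<open>F\<close> depends on
  \<open>x\<close> alone on the surface, while \<open>F'\<close> is arbitrary up to a continuous
  extension and enters through its even part. Thus orthogonality can be tested against polynomials
  that are not even in \<open>t\<close>.\<close>

lemma hyp_inner_eq_ball_inner:
  fixes F G :: "(real ^ 'd) \<times> real \<Rightarrow> real" and p q :: "real ^ 'd \<Rightarrow> real"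
  assumes \<rho>: "\<rho> \<ge> 0" "\<beta> > - 1/2" "\<gamma> > - 1/2"
    and p: "continuous_on UNIV p" and q: "continuous_on UNIV q" and G: "continuous_on UNIV G"
    and Fp: "\<And>x t. (x, t) \<in> hyp_surface \<rho> \<Longrightarrow> F (x, t) = p x"
    and F'G: "\<And>z. z \<in> hyp_surface \<rho> \<Longrightarrow> F' z = G z"
    and Gq: "\<And>x t. t\<^sup>2 = (norm x)\<^sup>2 + \<rho>\<^sup>2 \<Longrightarrow> G (x, t) + G (x, - t) = 2 * q x"
  shows "hyp_inner \<rho> \<beta> \<gamma> F F' = ball_inner \<beta> \<gamma> p q"
proof -
  have "hyp_integral \<rho> (\<lambda>(x, t). F (x, t) * F' (x, t) * hyp_weight \<rho> \<beta> \<gamma> t) =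
      hyp_integral \<rho> (\<lambda>(x, t). (\<lambda>z. F z * F' z) (x, t) * hyp_weight \<rho> \<beta> \<gamma> t)"
    by simp
  also have "\<dots> = ball_integral (\<beta> + real CARD('d) / 2) (\<gamma> + 1/2) (\<lambda>x. p x * q x)"
  proof (rule hyp_integral_eq_ball_integral[OF \<rho>, of "\<lambda>z. p (fst z) * G z"])
    show "continuous_on UNIV (\<lambda>z. p (fst z) * G z)"
      by (intro continuous_intros G continuous_on_compose2[OF p]) auto
    show "continuous_on UNIV (\<lambda>x. p x * q x)" by (intro continuous_intros p q)
    show "F z * F' z = p (fst z) * G z" if "z \<in> hyp_surface \<rho>" for z
      using Fp[of "fst z" "snd z"] F'G[of z] that by simp
    show "p (fst (x, t)) * G (x, t) + p (fst (x, - t)) * G (x, - t) = 2 * (p x * q x)"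
      if "t\<^sup>2 = (norm x)\<^sup>2 + \<rho>\<^sup>2" for x t
      using Gq[OF that] by (simp add: distrib_left[symmetric] del: distrib_left_numeral)
  qed
  moreover have "hyp_integral \<rho> (\<lambda>(x :: real ^ 'd, t). hyp_weight \<rho> \<beta> \<gamma> t) =
      ball_integral (\<beta> + real CARD('d) / 2) (\<gamma> + 1/2) (\<lambda>x :: real ^ 'd. 1)"
    using hyp_integral_eq_ball_integral[OF \<rho>, of "\<lambda>_. 1" "\<lambda>x :: real ^ 'd. 1" "\<lambda>_. 1"] by simp
  ultimately show ?thesis by (simp add: hyp_inner_def hyp_const_def ball_inner_def)
qed

lemma ball_inner_function_inner_product:
  assumes "\<beta> > - 1/2" "\<gamma> > - 1/2"
  shows "function_inner_product {f :: real ^ 'd \<Rightarrow> real. continuous_on UNIV f} (cball 0 1)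
    (ball_inner \<beta> \<gamma>)"
proof -
  let ?a = "\<beta> + real CARD('d) / 2" and ?b = "\<gamma> + 1/2"
  have "0 < CARD('d)" by simp
  then have "real CARD('d) \<ge> 1" by linarith
  then have ab: "?a > 0" "?b > 0" using assms by linarith+
  \<comment> \<open>Definiteness applied to the constant 1 shows that the normalization does not
    divide by 0.\<close>
  have "ball_integral ?a ?b (\<lambda>x :: real ^ 'd. 1) \<noteq> 0"
    using ball_integral_definite[OF ab, of "\<lambda>x :: real ^ 'd. 1" 0] by auto
  then show ?thesis
    using ball_function_inner_product[OF ab, of "1 / ball_integral ?a ?b (\<lambda>x :: real ^ 'd. 1)"]
    by (simp add: ball_inner_def[abs_def])
qed

lemma ball_kernel_exists:
  fixes y :: "real ^ 'd"
  assumes "\<beta> > - 1/2" "\<gamma> > - 1/2" and y: "y \<in> cball 0 1"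
  shows "\<exists>k\<in>x_polys_upto n. (\<forall>m<n. \<forall>g\<in>x_polys_upto m. ball_inner \<beta> \<gamma> k g = 0) \<and>
    (\<forall>f\<in>x_polys_upto n. (\<forall>m<n. \<forall>g\<in>x_polys_upto m. ball_inner \<beta> \<gamma> f g = 0) \<longrightarrow>
      ball_inner \<beta> \<gamma> f k = f y)"
proof -
  interpret function_inner_product "{f :: real ^ 'd \<Rightarrow> real. continuous_on UNIV f}" "cball 0 1"
    "ball_inner \<beta> \<gamma>"
    by (rule ball_inner_function_inner_product[OF assms(1,2)])
  \<comment> \<open>The union encodes degree at most n - 1 and is empty for n = 0; its span is then
    the zero function, orthogonal to everything, which matches the void condition.\<close>
  let ?J = "\<Union>m<n. exponents_upto m :: ('d \<Rightarrow> nat) set"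
  have J: "?J \<subseteq> exponents_upto n" by (auto simp: exponents_upto_def)
  have mono: "power_monomial ` exponents_upto n \<subseteq> {f :: real ^ 'd \<Rightarrow> real. continuous_on UNIV f}"
    by (auto simp: power_monomial_def[abs_def] intro!: continuous_intros)
  have orth: "(\<forall>m<n. \<forall>g\<in>x_polys_upto m. ball_inner \<beta> \<gamma> f g = 0) \<longleftrightarrow>
      (\<forall>g\<in>fun_span ?J power_monomial. ball_inner \<beta> \<gamma> f g = 0)"
    if f: "f \<in> x_polys_upto n" for f :: "real ^ 'd \<Rightarrow> real"
  proof (cases n)
    case 0
    have "ball_inner \<beta> \<gamma> f (\<lambda>x. 0) = 0"
      using ip_scale_right[of "\<lambda>x. 0" f 0] continuous_on_x_polys_upto[OF f] by simp
    then show ?thesis using 0 by (simp add: fun_span_def)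
  next
    case (Suc k)
    then have "?J = exponents_upto k" by (force simp: exponents_upto_def)
    moreover have "g \<in> x_polys_upto k" if "m < n" "g \<in> x_polys_upto m" for m and g :: "real ^ 'd \<Rightarrow> real"
      using x_polys_upto_mono[of m k] that Suc by auto
    ultimately show ?thesis using Suc by auto
  qed
  obtain k where k: "k \<in> x_polys_upto n" "\<forall>g\<in>fun_span ?J power_monomial. ball_inner \<beta> \<gamma> k g = 0"
    "\<forall>f\<in>x_polys_upto n. (\<forall>g\<in>fun_span ?J power_monomial. ball_inner \<beta> \<gamma> f g = 0) \<longrightarrow>
      ball_inner \<beta> \<gamma> f k = f y"
    using orthogonal_complement_kernel[OF finite_exponents_upto mono J y] by blast
  show ?thesis
    using k orth by (intro bexI[of _ k] conjI ballI impI) simp_all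
qed

section \<open>Pullback of the ball kernel to the surfaces\<close>

lemma hyp_surface_in_cball: "(x, t) \<in> hyp_surface \<rho> \<Longrightarrow> x \<in> cball 0 1"
proof -
  assume *: "(x, t) \<in> hyp_surface \<rho>"
  then have "t\<^sup>2 \<le> \<rho>\<^sup>2 + 1" using power_mono[of "\<bar>t\<bar>" "sqrt (\<rho>\<^sup>2 + 1)" 2] by (auto simp: hyp_surface_def)
  then have "(norm x)\<^sup>2 \<le> 1\<^sup>2" using * by (simp add: hyp_surface_def)
  then show ?thesis using power2_le_imp_le[of "norm x" 1] by simp
qed

text \<open>The order of quantifiers is the point: \<open>K\<close> is built from
  \<open>ball_inner\<close> before \<rho> is chosen, so a single \<open>K\<close> serves the cone
  and all hyperboloids.\<close>

lemma even_kernel_eq_ball_kernel: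
  fixes \<beta> \<gamma> :: real and n :: nat
  assumes \<beta>\<gamma>: "\<beta> > - 1/2" "\<gamma> > - 1/2"
  obtains K :: "real ^ 'd \<Rightarrow> real ^ 'd \<Rightarrow> real" where
    "\<And>\<rho> x t y s. \<rho> \<ge> 0 \<Longrightarrow> (x, t) \<in> hyp_surface \<rho> \<Longrightarrow> (y, s) \<in> hyp_surface \<rho> \<Longrightarrow>
       even_kernel \<rho> \<beta> \<gamma> n ((x, t), (y, s)) = K x y"
proof -
  let ?P = "\<lambda>(y :: real ^ 'd) k. k \<in> x_polys_upto n \<and>
      (\<forall>m<n. \<forall>g\<in>x_polys_upto m. ball_inner \<beta> \<gamma> k g = 0) \<and>
      (\<forall>f\<in>x_polys_upto n. (\<forall>m<n. \<forall>g\<in>x_polys_upto m. ball_inner \<beta> \<gamma> f g = 0) \<longrightarrow>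
        ball_inner \<beta> \<gamma> f k = f y)"
  \<comment> \<open>Kernel functions are picked separately for each \<open>y\<close>; no regularity
    in \<open>y\<close> has to be arranged.\<close>
  have "\<exists>k. \<forall>y\<in>cball 0 1. ?P y (k y)"
  proof (rule bchoice, rule ballI)
    fix y :: "real ^ 'd" assume "y \<in> cball 0 1"
    then show "\<exists>k. ?P y k"
      using ball_kernel_exists[OF \<beta>\<gamma>, of y n] by (simp only: Bex_def)
  qed
  then obtain k where K': "\<forall>y\<in>cball 0 1. ?P y (k y)" ..
  note K = bspec[OF K']
  note k = conjunct1[OF K] and k_orth = conjunct1[OF conjunct2[OF K], rule_format]
    and k_rep = conjunct2[OF conjunct2[OF K], rule_format]
  show ?thesis
  proof (rule that[of "\<lambda>x y. k y x"])
    fix \<rho> t s :: real and x y :: "real ^ 'd"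
    assume \<rho>: "\<rho> \<ge> 0" and xt: "(x, t) \<in> hyp_surface \<rho>" and ys: "(y, s) \<in> hyp_surface \<rho>"
    let ?S = "hyp_surface \<rho> :: ((real ^ 'd) \<times> real) set"
    let ?K = "\<lambda>((x, t), (y, s))\<in>?S \<times> ?S. k y x"
    have surface: "t\<^sup>2 = (norm x)\<^sup>2 + \<rho>\<^sup>2" if "(x, t) \<in> ?S" for x t
      using that by (simp add: hyp_surface_def)
    have "is_reproducing_kernel ?S (even_orth_space \<rho> \<beta> \<gamma> n) (hyp_inner \<rho> \<beta> \<gamma>) ?K"
      unfolding is_reproducing_kernel_def
    proof (intro conjI ballI)
      fix q assume q: "q \<in> ?S"
      obtain y s where q_eq: "q = (y, s)" by force
      have y: "y \<in> cball 0 1" using q hyp_surface_in_cball unfolding q_eq by blast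
      note ky = k[OF y]
      have slice: "(\<lambda>p\<in>?S. ?K (p, q)) = restrict (\<lambda>(x, t). k y x) ?S"
        using q by (auto simp: q_eq fun_eq_iff restrict_def)
      show "(\<lambda>p\<in>?S. ?K (p, q)) \<in> even_orth_space \<rho> \<beta> \<gamma> n"
        unfolding slice even_orth_space_def
      proof (intro CollectI exI conjI allI impI ballI)
        show "(\<lambda>(x, t). k y x) \<in> polys_upto n" by (rule x_polys_upto_in_polys_upto[OF ky])
        show "even_in_t (\<lambda>(x, t). k y x)" by (simp add: even_in_t_def)
        fix m and g :: "(real ^ 'd) \<times> real \<Rightarrow> real"
        assume m: "m < n" and g: "g \<in> polys_upto m"
        \<comment> \<open>The test polynomial \<open>g\<close> need not be even; its even part
          becomes a polynomial in \<open>x\<close> of degree at most \<open>m < n\<close>, to which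
          \<open>k y\<close> is orthogonal.\<close>
        obtain r where r: "r \<in> x_polys_upto m"
          "\<And>x t. t\<^sup>2 = (norm x)\<^sup>2 + \<rho>\<^sup>2 \<Longrightarrow> g (x, t) + g (x, - t) = 2 * r x"
          using polys_upto_even_part[OF g] by blast
        have "hyp_inner \<rho> \<beta> \<gamma> (\<lambda>(x, t). k y x) g = ball_inner \<beta> \<gamma> (k y) r"
          by (rule hyp_inner_eq_ball_inner[OF \<rho> \<beta>\<gamma> continuous_on_x_polys_upto[OF ky]
                continuous_on_x_polys_upto[OF r(1)] continuous_on_polys_upto[OF g]])
             (simp_all add: r(2))
        then show "hyp_inner \<rho> \<beta> \<gamma> (\<lambda>(x, t). k y x) g = 0"
          using k_orth[OF y m r(1)] by simp
      qed simp
      fix f :: "(real ^ 'd) \<times> real \<Rightarrow> real"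
      assume "f \<in> even_orth_space \<rho> \<beta> \<gamma> n"
      then obtain f' where f: "f = restrict f' ?S" and f': "f' \<in> polys_upto n" "even_in_t f'"
        and f'_orth: "\<And>m g. m < n \<Longrightarrow> g \<in> polys_upto m \<Longrightarrow> hyp_inner \<rho> \<beta> \<gamma> f' g = 0"
        by (auto simp: even_orth_space_def)
      obtain p where p: "p \<in> x_polys_upto n"
        "\<And>x t. t\<^sup>2 = (norm x)\<^sup>2 + \<rho>\<^sup>2 \<Longrightarrow> f' (x, t) + f' (x, - t) = 2 * p x"
        using polys_upto_even_part[OF f'(1)] by blast
      have f'p: "f' (x, t) = p x" if "(x, t) \<in> ?S" for x t
        using p(2)[OF surface[OF that]] f'(2) by (simp add: even_in_t_def)
      \<comment> \<open>\<open>F\<close> and \<open>G\<close> are prescribed on the surface only, so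
        that the fact applies both to \<open>f'\<close> against test polynomials and to restrictions
        against the kernel slice.\<close>
      have inner: "hyp_inner \<rho> \<beta> \<gamma> F G = ball_inner \<beta> \<gamma> p g"
        if "g \<in> x_polys_upto m" "\<And>x t. (x, t) \<in> ?S \<Longrightarrow> F (x, t) = f' (x, t)"
          "\<And>x t. (x, t) \<in> ?S \<Longrightarrow> G (x, t) = g x" for F G g m
      proof (rule hyp_inner_eq_ball_inner[OF \<rho> \<beta>\<gamma> continuous_on_x_polys_upto[OF p(1)]
            continuous_on_x_polys_upto[OF that(1)]])
        show "continuous_on UNIV (\<lambda>z. g (fst z))"
          by (rule continuous_on_compose2[OF continuous_on_x_polys_upto[OF that(1)]])
             (auto intro: continuous_intros)
      qed (use that(2,3) f'p in \<open>auto simp: split_paired_all\<close>)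
      \<comment> \<open>Orthogonality passes from the surface to the ball, because every polynomial
        in \<open>x\<close> is also a polynomial in \<open>(x, t)\<close> of the same degree
        bound.\<close>
      have "ball_inner \<beta> \<gamma> p g = 0" if "m < n" "g \<in> x_polys_upto m" for m g
        using f'_orth[OF that(1) x_polys_upto_in_polys_upto[OF that(2)]]
          inner[OF that(2), of f' "\<lambda>(x, t). g x"] by simp
      then have "ball_inner \<beta> \<gamma> p (k y) = p y" by (intro k_rep[OF y p(1)]) auto
      then show "hyp_inner \<rho> \<beta> \<gamma> f (\<lambda>p\<in>?S. ?K (p, q)) = f q"
        unfolding slice using q inner[OF ky, of f "restrict (\<lambda>(x, t). k y x) ?S"]
        by (simp add: f f'p q_eq)
    qed simp
    \<comment> \<open>The symmetry of the inner product makes reproducing kernels unique, so the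
      description operator picks \<open>?K\<close>.\<close>
    then have "even_kernel \<rho> \<beta> \<gamma> n = ?K"
      unfolding even_kernel_def by (intro reproducing_kernel_eqI hyp_inner_commute)
    then show "even_kernel \<rho> \<beta> \<gamma> n ((x, t), (y, s)) = k y x"
      using xt ys by simp
  qed
qed

theorem proposition5p3:
  fixes \<rho> \<beta> \<gamma> t s :: real and x y :: "real ^ 'd" and n :: nat
  assumes "CARD('d) \<ge> 2" and "\<rho> > 0" and "\<beta> > - 1/2" and "\<gamma> > - 1/2"
    and "(x, t) \<in> hyp_surface \<rho>" and "(y, s) \<in> hyp_surface \<rho>"
  shows "even_kernel \<rho> \<beta> \<gamma> n ((x, t), (y, s)) =
           even_kernel 0 \<beta> \<gamma> n ((x, sqrt (t\<^sup>2 - \<rho>\<^sup>2)), (y, sqrt (s\<^sup>2 - \<rho>\<^sup>2)))"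
proof -
  obtain K :: "real ^ 'd \<Rightarrow> real ^ 'd \<Rightarrow> real" where
    K: "\<And>\<rho> x t y s. \<rho> \<ge> 0 \<Longrightarrow> (x, t) \<in> hyp_surface \<rho> \<Longrightarrow> (y, s) \<in> hyp_surface \<rho> \<Longrightarrow>
       even_kernel \<rho> \<beta> \<gamma> n ((x, t), (y, s)) = K x y"
    using even_kernel_eq_ball_kernel[OF assms(3,4)] by blast
  \<comment> \<open>On the surface \<open>sqrt (t\<^sup>2 - \<rho>\<^sup>2)\<close> equals
    \<open>norm x\<close>, which is at most 1; so the new point lies on the upper half of the cone
    over the same \<open>x\<close>.\<close>
  have cone: "(x, sqrt (t\<^sup>2 - \<rho>\<^sup>2)) \<in> hyp_surface 0" if "(x, t) \<in> hyp_surface \<rho>"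
    for x :: "real ^ 'd" and t
  proof -
    have "sqrt (t\<^sup>2 - \<rho>\<^sup>2) = norm x" using that by (intro real_sqrt_unique) (auto simp: hyp_surface_def)
    then show ?thesis using hyp_surface_in_cball[OF that] by (simp add: hyp_surface_def)
  qed
  show ?thesis
    using K[OF _ assms(5,6)] K[OF _ cone[OF assms(5)] cone[OF assms(6)]] assms(2) by simp
qed

end
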